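(* Let $(A,+,\circ)$ be a left brace of cardinality $p^{n}$, where $p$ is a prime with $p>n+1$. Let $\gamma$ be a primitive root modulo $p^{p}$ and $\xi=\gamma^{p^{p-1}}$. Define on $A/ann(p^{2})$ \[[x]\bullet[y]=\sum_{i=0}^{p-2}\xi^{p-1-i}\,[\xi^{i}x]\odot[y],\qquad x,y\in A,\] where $[x]\odot[y]=[\wp^{-1}((px)*y)]$. Then $(A/ann(p^{2}),+,\bullet)$ is a pre-Lie ring.
   Context: A (left) brace is a set $A$ with operations $+,\circ$ such that $(A,+)$ is an abelian group, $(A,\circ)$ is a group, and $a\circ(b+c)+a=a\circ b+a\circ c$; $a*b=a\circ b-a-b$. $pA=\{pa:a\in A\}$; $\wp^{-1}:pA\to A$ is a fixed function with $p\,\wp^{-1}(a)=a$. $ann(p^{2})=\{a\in A:p^{2}a=0\}$ is an ideal (for $p>n+1$) and $[a]=a+ann(p^{2})$; the operation $\odot$ is well defined on cosets. A pre-Lie ring is an abelian group with a bi-additive operation $\cdot$ satisfying $(x\cdot y)\cdot z-x\cdot(y\cdot z)=(y\cdot x)\cdot z-y\cdot(x\cdot z)$. *)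

theory Defs
  imports "HOL-Number_Theory.Number_Theory"
begin

definition gmult :: "nat \<Rightarrow> 'a::ab_group_add \<Rightarrow> 'a" where
  "gmult n x = (\<Sum>i<n. x)"

definition left_brace :: "('a::ab_group_add \<Rightarrow> 'a \<Rightarrow> 'a) \<Rightarrow> bool" where
  "left_brace circ \<longleftrightarrow>
     (\<forall>a b c. circ (circ a b) c = circ a (circ b c)) \<and>
     (\<exists>e. (\<forall>a. circ e a = a \<and> circ a e = a) \<and>
          (\<forall>a. \<exists>b. circ b a = e \<and> circ a b = e)) \<and>
     (\<forall>a b c. circ a (b + c) + a = circ a b + circ a c)"

definition brace_star :: "('a::ab_group_add \<Rightarrow> 'a \<Rightarrow> 'a) \<Rightarrow> 'a \<Rightarrow> 'a \<Rightarrow> 'a" where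
  "brace_star circ a b = circ a b - a - b"

definition ann :: "nat \<Rightarrow> 'a::ab_group_add set" where
  "ann m = {a. gmult m a = 0}"

definition cong_ann :: "nat \<Rightarrow> 'a::ab_group_add \<Rightarrow> 'a \<Rightarrow> bool" where
  "cong_ann p x y \<longleftrightarrow> x - y \<in> ann (p^2)"

(* representative of [x] \<bullet> [y] :
   sum_{i=0}^{p-2} xi^(p-1-i) * wp((p (xi^i x)) * y) *)
definition bullet ::
  "('a::ab_group_add \<Rightarrow> 'a \<Rightarrow> 'a) \<Rightarrow> ('a \<Rightarrow> 'a) \<Rightarrow> nat \<Rightarrow> nat \<Rightarrow> 'a \<Rightarrow> 'a \<Rightarrow> 'a" where
  "bullet circ wp p xi x y =
     (\<Sum>i\<in>{0..p-2}. gmult (xi^(p-1-i))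
        (wp (brace_star circ (gmult p (gmult (xi^i) x)) y)))"

end

theory Submission
  imports Defs "HOL-Library.Product_Plus" "HOL-Algebra.Group_Action"
begin

text \<open>Since \<open>p > n + 1\<close>, the \<open>p ^ j\<close>-th powers of the circle group control \<open>p ^ j A\<close>, so \<open>x \<mapsto> (px) * y\<close>
  behaves like a power series whose degree \<open>k\<close> part is divisible by \<open>p ^ k\<close>: its \<open>k\<close>-fold finite
  differences lie in \<open>p ^ k A\<close>. Hence it is polynomial of degree less than \<open>p\<close>, and averaging over
  the \<open>(p - 1)\<close>-st roots of unity extracts \<open>p - 1\<close> times its linear part, \<open>\<Lambda>\<close>, with \<open>p (x \<bullet> y) = \<Lambda> x y\<close>.
  Taking the component of bidegree (1, 1) of \<open>(a \<circ> b) * c - (b \<circ> a) * c = a * (b * c) - b * (a * c)\<close>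
  at \<open>a = px\<close>, \<open>b = py\<close> gives \<open>\<Lambda> (\<Lambda> x y) z - \<Lambda> (\<Lambda> y x) z = \<Lambda> x (\<Lambda> y z) - \<Lambda> y (\<Lambda> x z)\<close>, because the
  contribution of the quadratic part is symmetric in \<open>x\<close> and \<open>y\<close>. This is \<open>p\<^sup>2\<close> times the pre-Lie
  identity.\<close>

section \<open>Integer multiples\<close>

lemma gmult_0 [simp]: "gmult 0 x = 0"
  by (simp add: gmult_def)

lemma gmult_Suc: "gmult (Suc m) x = x + gmult m x"
  by (simp add: gmult_def add.commute)

lemma gmult_1 [simp]: "gmult (Suc 0) x = x"
  by (simp add: gmult_Suc)

lemma gmult_zero [simp]: "gmult m 0 = 0"
  by (simp add: gmult_def)

lemma gmult_add_right: "gmult m (x + y) = gmult m x + gmult m y"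
  by (simp add: gmult_def sum.distrib)

lemma gmult_minus: "gmult m (- x) = - gmult m x"
  by (simp add: gmult_def sum_negf)

lemma gmult_diff: "gmult m (x - y) = gmult m x - gmult m y"
  by (simp add: gmult_def sum_subtractf)

lemma gmult_add_left: "gmult (m + k) x = gmult m x + gmult k x"
  by (induction m) (simp_all add: gmult_Suc add.assoc)

lemma gmult_mult: "gmult (m * k) x = gmult m (gmult k x)"
  by (induction m) (simp_all add: gmult_Suc gmult_add_left)

lemma gmult_commute: "gmult m (gmult k x) = gmult k (gmult m x)"
  by (metis gmult_mult mult.commute)

lemma gmult_sum: "gmult m (sum f S) = (\<Sum>i\<in>S. gmult m (f i))"
  by (induction S rule: infinite_finite_induct) (simp_all add: gmult_add_right)

lemma gmult_Pair: "gmult m (x, y) = (gmult m x, gmult m y)"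
  by (induction m) (simp_all add: gmult_Suc zero_prod_def)

lemma gmult_additive:
  assumes "additive T"
  shows "T (gmult m x) = gmult m (T x)"
  using assms by (induction m) (simp_all add: gmult_Suc additive.add additive.zero)

text \<open>Translation by \<open>a\<close> permutes the group, so adding \<open>card UNIV\<close>
  copies of \<open>a\<close> leaves the sum of all elements unchanged.\<close>

lemma gmult_card_UNIV: "gmult (card (UNIV :: 'a set)) (a :: 'a :: {ab_group_add, finite}) = 0"
proof -
  have "(\<Sum>x\<in>UNIV. x + a) = (\<Sum>x\<in>UNIV. x)"
    by (rule sum.reindex_bij_witness[where i = "\<lambda>x. x - a" and j = "\<lambda>x. x + a"]) auto
  moreover have "(\<Sum>x\<in>S. a) = gmult (card S) a" for S :: "'a set"
    by (induction S rule: infinite_finite_induct) (simp_all add: gmult_Suc)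
  ultimately show ?thesis
    by (simp add: sum.distrib)
qed

lemma gmult_gcd_eq_0:
  assumes "gmult m x = 0" "gmult k x = 0"
  shows "gmult (gcd m k) x = 0"
proof (cases "m = 0")
  case False
  then obtain u v where "m * u = k * v + gcd m k"
    using bezout_nat by blast
  then have "gmult u (gmult m x) = gmult v (gmult k x) + gmult (gcd m k) x"
    by (metis gmult_add_left gmult_mult mult.commute)
  then show ?thesis
    using assms by simp
qed (use assms in simp)

text \<open>\<open>a - b\<close> is coprime to \<open>p ^ n\<close>, so by Bezout it acts
  injectively. This is the cancellation rule for all comparisons of degrees.\<close>

lemma gmult_eq_imp_eq_0:
  assumes "gmult (p ^ n) x = 0" "prime p" "gmult a x = gmult b x" "b \<le> a" "\<not> p dvd a - b"
  shows "x = 0"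
proof -
  have "gmult (a - b) x = 0"
    using assms(3,4) by (metis add_diff_cancel_left' add_right_cancel gmult_add_left le_add_diff_inverse2 add_0)
  then have "gmult (gcd (p ^ n) (a - b)) x = 0"
    using assms(1) gmult_gcd_eq_0 by blast
  moreover have "gcd (p ^ n) (a - b) = 1"
    using assms(2,5) by (simp add: coprime_power_left_iff prime_imp_coprime)
  ultimately show ?thesis by simp
qed

section \<open>The subgroups of \<open>m\<close>-fold multiples\<close>

definition multiples :: "nat \<Rightarrow> 'a::ab_group_add set" where
  "multiples m = range (gmult m)"

lemma multiples_1 [simp]: "x \<in> multiples (Suc 0)"
  by (auto simp: multiples_def)

lemma zero_multiples [simp]: "0 \<in> multiples m"
  unfolding multiples_def by (metis gmult_zero rangeI)

lemma gmult_multiples [simp]: "gmult m x \<in> multiples m"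
  by (simp add: multiples_def)

lemma multiples_add: "x \<in> multiples m \<Longrightarrow> y \<in> multiples m \<Longrightarrow> x + y \<in> multiples m"
  unfolding multiples_def by (auto simp flip: gmult_add_right)

lemma multiples_minus: "x \<in> multiples m \<Longrightarrow> - x \<in> multiples m"
  unfolding multiples_def by (auto simp flip: gmult_minus)

lemma multiples_sum: "(\<And>i. i \<in> S \<Longrightarrow> f i \<in> multiples m) \<Longrightarrow> sum f S \<in> multiples m"
  by (induction S rule: infinite_finite_induct) (auto intro: multiples_add)

lemma multiples_dvd: "x \<in> multiples m \<Longrightarrow> k dvd m \<Longrightarrow> x \<in> multiples k"
  by (auto simp: multiples_def gmult_mult dvd_def)

section \<open>Finite differences\<close>

definition fdiff :: "'b::ab_group_add \<Rightarrow> ('b \<Rightarrow> 'a::ab_group_add) \<Rightarrow> 'b \<Rightarrow> 'a" where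
  "fdiff h f x = f (x + h) - f x"

primrec fdiffs :: "'b::ab_group_add list \<Rightarrow> ('b \<Rightarrow> 'a::ab_group_add) \<Rightarrow> 'b \<Rightarrow> 'a" where
  "fdiffs [] f = f"
| "fdiffs (h # hs) f = fdiffs hs (fdiff h f)"

lemma fdiffs_append: "fdiffs (hs @ hs') f = fdiffs hs' (fdiffs hs f)"
  by (induction hs arbitrary: f) simp_all

lemma fdiffs_add: "fdiffs hs (\<lambda>x. f x + g x) = (\<lambda>x. fdiffs hs f x + fdiffs hs g x)"
proof (induction hs arbitrary: f g)
  case (Cons h hs)
  have "fdiff h (\<lambda>x. f x + g x) = (\<lambda>x. fdiff h f x + fdiff h g x)"
    by (auto simp: fdiff_def)
  then show ?case by (simp add: Cons)
qed simp

lemma fdiffs_zero [simp]: "fdiffs hs (\<lambda>_. 0) = (\<lambda>_. 0)"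
  by (induction hs) (simp_all add: fdiff_def[abs_def])

lemma fdiffs_gmult: "fdiffs hs (\<lambda>x. gmult m (f x)) = (\<lambda>x. gmult m (fdiffs hs f x))"
  by (induction m) (simp_all add: gmult_Suc fdiffs_add)

lemma fdiffs_shift: "fdiffs hs (\<lambda>x. f (x + c)) = (\<lambda>x. fdiffs hs f (x + c))"
proof (induction hs arbitrary: f)
  case (Cons h hs)
  have "fdiff h (\<lambda>x. f (x + c)) = (\<lambda>x. fdiff h f (x + c))"
    by (auto simp: fdiff_def algebra_simps)
  then show ?case by (simp add: Cons)
qed simp

lemma fdiffs_dilate: "fdiffs hs (\<lambda>x. f (gmult m x)) = (\<lambda>x. fdiffs (map (gmult m) hs) f (gmult m x))"
proof (induction hs arbitrary: f)
  case (Cons h hs)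
  have "fdiff h (\<lambda>x. f (gmult m x)) = (\<lambda>x. fdiff (gmult m h) f (gmult m x))"
    by (auto simp: fdiff_def gmult_add_right)
  then show ?case by (simp add: Cons)
qed simp

text \<open>The top nonvanishing differences are independent of the base point and multiadditive.\<close>

lemma fdiffs_top_gmult:
  assumes "\<And>hs x. length hs = Suc d \<Longrightarrow> fdiffs hs f x = 0" "length hs = d"
  shows "fdiffs (map (gmult m) hs) f x = gmult (m ^ d) (fdiffs hs f x)"
  using assms
proof (induction d arbitrary: hs f x)
  case (Suc d)
  then obtain h hs' where hs: "hs = h # hs'" "length hs' = d"
    by (metis length_Suc_conv)
  \<comment> \<open>One more difference in direction \<open>h\<close> has order \<open>d + 2\<close>
    and vanishes, so shifting the base point by \<open>h\<close> changes nothing.\<close>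
  have const: "fdiffs hs' (fdiff c f) (y + h) = fdiffs hs' (fdiff c f) y" for c y
  proof -
    have "fdiffs (c # hs' @ [h]) f y = 0"
      using Suc.prems(1)[of "c # hs' @ [h]"] hs by simp
    then show ?thesis by (simp add: fdiffs_append fdiff_def)
  qed
  \<comment> \<open>A step \<open>(k + 1) h\<close> is a step \<open>h\<close> followed by a step
    \<open>k h\<close> from the shifted point; \<open>const\<close> removes the shift.\<close>
  have mult: "fdiffs hs' (fdiff (gmult k h) f) y = gmult k (fdiffs hs' (fdiff h f) y)" for k y
  proof (induction k arbitrary: y)
    case 0
    then show ?case by (simp add: fdiff_def[abs_def])
  next
    case (Suc k)
    have "fdiff (gmult (Suc k) h) f = (\<lambda>x. fdiff h f x + fdiff (gmult k h) f (x + h))"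
      by (auto simp: fdiff_def gmult_Suc algebra_simps)
    then have "fdiffs hs' (fdiff (gmult (Suc k) h) f) y =
        fdiffs hs' (fdiff h f) y + fdiffs hs' (fdiff (gmult k h) f) (y + h)"
      by (simp add: fdiffs_add fdiffs_shift)
    then show ?case by (simp add: const Suc gmult_Suc)
  qed
  have "fdiffs (map (gmult m) hs') (fdiff (gmult m h) f) x
      = gmult (m ^ d) (fdiffs hs' (fdiff (gmult m h) f) x)"
  proof (rule Suc.IH[OF _ hs(2)])
    fix hs :: "'a list" and y assume "length hs = Suc d"
    then show "fdiffs hs (fdiff (gmult m h) f) y = 0"
      using Suc.prems(1)[of "gmult m h # hs"] by simp
  qed
  then show ?case
    by (simp add: hs mult flip: gmult_mult) (simp add: mult.commute)
qed simp

text \<open>Dilating by \<open>m\<close> multiplies a top difference of order \<open>d\<close> both by \<open>m ^ d\<close> and, by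
  homogeneity, by \<open>m\<close>; hence the differences of order \<open>d \<ge> 2\<close> vanish by descending induction.\<close>

lemma homogeneous_imp_additive:
  fixes f :: "'b::ab_group_add \<Rightarrow> 'a::ab_group_add"
  assumes p: "prime p" and tors: "\<And>a::'a. gmult (p ^ n) a = 0"
    and hom: "\<And>x. f (gmult m x) = gmult m (f x)"
    and van: "\<And>hs x. length hs = d \<Longrightarrow> fdiffs hs f x = 0"
    and m: "m > 0" "\<not> p dvd m" "\<And>k. 0 < k \<Longrightarrow> k < d \<Longrightarrow> \<not> p dvd m ^ k - 1"
    and m1: "\<not> p dvd m - 1"
  shows "additive f"
proof -
  \<comment> \<open>\<open>m ^ (k + 1) - m = m (m ^ k - 1)\<close> is prime to \<open>p\<close>, so
    a part of degree \<open>k + 1 > 1\<close> contradicts homogeneity of degree 1.\<close>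
  have cancel: "x = 0" if "gmult (m ^ Suc k) x = gmult m x" "0 < k" "k < d" for k and x :: 'a
  proof (rule gmult_eq_imp_eq_0[OF tors p that(1)])
    show "m \<le> m ^ Suc k" using m(1) by (simp add: Suc_leI)
    have "m ^ Suc k - m = m * (m ^ k - 1)" by (simp add: algebra_simps)
    then show "\<not> p dvd m ^ Suc k - m"
      using m that p by (metis prime_dvd_mult_iff)
  qed
  \<comment> \<open>The vanishing order descends from \<open>d\<close> one step at a time. The
    \<open>max\<close> stops it at 2, because in order 1 there is nothing to cancel.\<close>
  have red: "\<forall>hs x. length hs = max 2 (d - k) \<longrightarrow> fdiffs hs f x = 0" if "2 \<le> d" for k
  proof (induction k)
    case 0
    then show ?case using van that by (simp add: max_def)
  next
    case (Suc k)
    show ?case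
    proof (cases "d - k \<le> 2")
      case True
      then show ?thesis using Suc by (simp add: max_def split: if_splits)
    next
      case False
      define e where "e = d - Suc k - 1"
      have e: "max 2 (d - Suc k) = Suc e" "d - k = Suc (Suc e)" "0 < e" "e < d"
        using False by (auto simp: e_def)
      have van': "\<And>hs x. length hs = Suc (Suc e) \<Longrightarrow> fdiffs hs f x = 0"
        using Suc e False by (simp add: max_def split: if_splits)
      have "fdiffs hs f x = 0" if hs: "length hs = Suc e" for hs x
      proof -
        have "fdiffs hs f (gmult m x) = fdiffs hs f x" for x
        proof -
          have "fdiff c (fdiffs hs f) x = 0" for c x
            using van'[of "hs @ [c]"] hs by (simp add: fdiffs_append)
          from this[of "gmult m x - x" x] show ?thesis by (simp add: fdiff_def)
        qed
        moreover have "fdiffs (map (gmult m) hs) f (gmult m x) = gmult m (fdiffs hs f x)"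
          using fdiffs_dilate[of hs f m] by (simp add: hom fdiffs_gmult fun_eq_iff)
        ultimately have "gmult (m ^ Suc e) (fdiffs hs f x) = gmult m (fdiffs hs f x)"
          using fdiffs_top_gmult[OF van' hs] by simp
        then show ?thesis using cancel e by blast
      qed
      then show ?thesis using e by simp
    qed
  qed
  have van2: "fdiffs hs f x = 0" if "length hs = 2" for hs x
  proof (cases "2 \<le> d")
    case True
    then show ?thesis using red[of d] that by simp
  next
    \<comment> \<open>If \<open>d < 2\<close>, the first \<open>d\<close> steps already produce the
      zero function.\<close>
    case False
    then have "length (take d hs) = d" using that by simp
    then have "fdiffs (take d hs) f = (\<lambda>_. 0)"
      using van by auto
    then have "fdiffs (take d hs @ drop d hs) f x = 0"
      by (simp only: fdiffs_append fdiffs_zero)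
    then show ?thesis by simp
  qed
  have f0: "f 0 = 0"
    by (rule gmult_eq_imp_eq_0[OF tors p, of m _ 1]) (use hom[of 0] m m1 in auto)
  show ?thesis
  proof
    fix x y
    have "fdiffs [x, y] f 0 = 0" by (rule van2) simp
    then show "f (x + y) = f x + f y" by (simp add: fdiff_def f0 algebra_simps)
  qed
qed

text \<open>For \<open>i \<le> k\<close> the \<open>i\<close>-fold differences of \<open>f\<close> are divisible by \<open>p ^ (i + j)\<close>.\<close>

primrec graded :: "nat \<Rightarrow> nat \<Rightarrow> nat \<Rightarrow> ('b::ab_group_add \<Rightarrow> 'a::ab_group_add) \<Rightarrow> bool" where
  "graded p 0 j f \<longleftrightarrow> (\<forall>x. f x \<in> multiples (p ^ j))"
| "graded p (Suc k) j f \<longleftrightarrow> (\<forall>x. f x \<in> multiples (p ^ j)) \<and> (\<forall>h. graded p k (Suc j) (fdiff h f))"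

lemma graded_multiples: "graded p k j f \<Longrightarrow> f x \<in> multiples (p ^ j)"
  by (cases k) auto

lemma graded_fdiffs: "graded p (length hs) j f \<Longrightarrow> fdiffs hs f x \<in> multiples (p ^ (j + length hs))"
  by (induction hs arbitrary: j f) fastforce+

lemma graded_SucD: "graded p (Suc k) j f \<Longrightarrow> graded p k j f"
proof (induction k arbitrary: j f)
  case (Suc k)
  then show ?case
    by (subst graded.simps(2), subst (asm) graded.simps(2)) blast
qed (simp add: graded_multiples)

lemma graded_decr: "graded p k (Suc j) f \<Longrightarrow> graded p k j f"
  by (induction k arbitrary: j f) (auto intro: multiples_dvd)

lemma graded_zero [simp]: "graded p k j (\<lambda>_. 0)"
  by (induction k arbitrary: j) (simp_all add: fdiff_def[abs_def])

lemma graded_const: "graded p k 0 (\<lambda>_. c)"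
  by (cases k) (simp_all add: fdiff_def[abs_def])

lemma graded_add:
  "graded p k j f \<Longrightarrow> graded p k j g \<Longrightarrow> graded p k j (\<lambda>x. f x + g x)"
proof (induction k arbitrary: j f g)
  case (Suc k)
  have "fdiff h (\<lambda>x. f x + g x) = (\<lambda>x. fdiff h f x + fdiff h g x)" for h
    by (auto simp: fdiff_def)
  then show ?case using Suc by (auto intro: multiples_add)
qed (auto intro: multiples_add)

lemma graded_minus:
  "graded p k j f \<Longrightarrow> graded p k j (\<lambda>x. - f x)"
proof (induction k arbitrary: j f)
  case (Suc k)
  have "fdiff h (\<lambda>x. - f x) = (\<lambda>x. - fdiff h f x)" for h
    by (auto simp: fdiff_def)
  then show ?case using Suc by (auto intro: multiples_minus)
qed (auto intro: multiples_minus)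

lemma graded_diff:
  "graded p k j f \<Longrightarrow> graded p k j g \<Longrightarrow> graded p k j (\<lambda>x. f x - g x)"
  using graded_add[OF _ graded_minus, of p k j f g] by simp

lemma graded_sum:
  "(\<And>i. i \<in> S \<Longrightarrow> graded p k j (f i)) \<Longrightarrow> graded p k j (\<lambda>x. \<Sum>i\<in>S. f i x)"
  by (induction S rule: infinite_finite_induct) (auto intro: graded_add)

lemma graded_gmult: "graded p k j f \<Longrightarrow> graded p k j (\<lambda>x. gmult m (f x))"
  unfolding gmult_def by (rule graded_sum)

text \<open>An additive substitution turns the step \<open>h\<close> into the step
  \<open>A h\<close>, so no power of \<open>p\<close> is lost.\<close>

lemma graded_comp_affine:
  fixes A :: "'c::ab_group_add \<Rightarrow> 'b::ab_group_add"
  assumes "additive A" "graded p k j f"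
  shows "graded p k j (\<lambda>x. f (A x + c))"
  using assms(2)
proof (induction k arbitrary: j f)
  case (Suc k)
  have "fdiff h (\<lambda>x. f (A x + c)) = (\<lambda>x. fdiff (A h) f (A x + c))" for h
    by (auto simp: fdiff_def additive.add[OF assms(1)] algebra_simps)
  then show ?case using Suc by simp
qed simp

lemma graded_shift: "graded p k j f \<Longrightarrow> graded p k j (\<lambda>x. f (x + c))"
  by (rule graded_comp_affine[where A = "\<lambda>x. x"]) (simp_all add: additive.intro)

text \<open>Leibniz rule: a difference of \<open>T x (g x)\<close> is a difference of
  \<open>T\<close> at the shifted \<open>g\<close>, plus \<open>T\<close> at a difference of
  \<open>g\<close>. Each summand gains one power of \<open>p\<close>, and additivity of
  \<open>T x\<close> pulls out the powers contained in \<open>g x\<close>.\<close>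

lemma graded_apply:
  assumes "\<And>x. additive (T x)" "\<And>y. graded p k i (\<lambda>x. T x y)" "graded p k j g"
  shows "graded p k (i + j) (\<lambda>x. T x (g x))"
  using assms
proof (induction k arbitrary: i j T g)
  case 0
  show ?case
  proof (simp, intro allI)
    fix x
    obtain a where a: "g x = gmult (p ^ j) a" using 0(3) by (auto simp: multiples_def)
    obtain b where "T x a = gmult (p ^ i) b" using 0(2)[of a] by (auto simp: multiples_def)
    then have "T x (g x) = gmult (p ^ (i + j)) b"
      by (simp add: a gmult_additive[OF 0(1)] power_add mult.commute flip: gmult_mult)
    then show "T x (g x) \<in> multiples (p ^ (i + j))" by simp
  qed
next
  case (Suc k)
  have "T x (g x) \<in> multiples (p ^ (i + j))" for x
  proof -
    obtain a where a: "g x = gmult (p ^ j) a" using Suc(4) by (auto simp: multiples_def)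
    obtain b where "T x a = gmult (p ^ i) b" using Suc(3)[of a] by (auto simp: multiples_def)
    then have "T x (g x) = gmult (p ^ (i + j)) b"
      by (simp add: a gmult_additive[OF Suc(2)] power_add mult.commute flip: gmult_mult)
    then show ?thesis by simp
  qed
  moreover have "graded p k (Suc (i + j)) (fdiff h (\<lambda>x. T x (g x)))" for h
  proof -
    have "fdiff h (\<lambda>x. T x (g x)) =
        (\<lambda>x. (T (x + h) (g (x + h)) - T x (g (x + h))) + T x (fdiff h g x))"
      by (auto simp: fdiff_def additive.diff[OF Suc(2)])
    moreover have "graded p k (Suc i + j) (\<lambda>x. T (x + h) (g (x + h)) - T x (g (x + h)))"
    proof (rule Suc.IH[where T = "\<lambda>x y. T (x + h) y - T x y" and g = "\<lambda>x. g (x + h)"])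
      show "additive (\<lambda>y. T (x + h) y - T x y)" for x
        using Suc(2) by (auto intro!: additive.intro simp: additive.add algebra_simps)
      show "graded p k (Suc i) (\<lambda>x. T (x + h) y - T x y)" for y
        using Suc(3)[of y] by (simp add: fdiff_def[abs_def])
      show "graded p k j (\<lambda>x. g (x + h))"
        by (rule graded_shift[OF graded_SucD[OF Suc(4)]])
    qed
    moreover have "graded p k (i + Suc j) (\<lambda>x. T x (fdiff h g x))"
      by (rule Suc.IH[where T = T and g = "fdiff h g", OF Suc(2) graded_SucD[OF Suc(3)]])
        (use Suc(4) in simp)
    ultimately show ?thesis
      using graded_add by simp
  qed
  ultimately show ?case by simp
qed

section \<open>Averaging over the Teichmueller units\<close>

text \<open>Each \<open>p\<close>-th power gains one factor \<open>p\<close>: in the expansion of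
  \<open>(1 + p ^ (k + 1) d) ^ p\<close> the linear term has the extra factor \<open>p\<close>, and
  the later terms are divisible by \<open>p ^ (2 (k + 1))\<close>.\<close>

lemma cong_prime_power_imp_cong_1:
  fixes a p :: nat
  assumes "[a = 1] (mod p)"
  shows "[a ^ (p ^ k) = 1] (mod p ^ Suc k)"
proof -
  \<comment> \<open>Over the integers, since the cofactor \<open>c\<close> of \<open>a - 1\<close>
    may be negative.\<close>
  have "[(1 + int p * c) ^ (p ^ k) = 1] (mod int p ^ Suc k)" for c
  proof (induction k)
    case 0
    then show ?case by (simp add: cong_iff_dvd_diff)
  next
    case (Suc k)
    then obtain d where d: "(1 + int p * c) ^ (p ^ k) = 1 + int p ^ Suc k * d"
      by (metis cong_iff_lin cong_sym)
    have "(1 + int p * c) ^ (p ^ Suc k) = (1 + int p ^ Suc k * d) ^ p"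
      by (metis d power_Suc2 power_mult)
    also have "\<dots> = (\<Sum>i\<le>p. of_nat (p choose i) * (int p ^ Suc k * d) ^ i)"
      using binomial_ring[of "int p ^ Suc k * d" 1 p] by (simp add: add.commute)
    also have "[\<dots> = (\<Sum>i\<le>p. if i = 0 then 1 else 0)] (mod int p ^ Suc (Suc k))"
    proof (rule cong_sum)
      fix i assume "i \<in> {..p}"
      consider "i = 0" | "i = 1" | "i \<ge> 2" by linarith
      then show "[of_nat (p choose i) * (int p ^ Suc k * d) ^ i = (if i = 0 then 1 else 0)]
          (mod int p ^ Suc (Suc k))"
      proof cases
        case 3
        have "int p ^ Suc (Suc k) dvd int p ^ (Suc k * 2)"
          by (rule le_imp_power_dvd) simp
        also have "\<dots> dvd int p ^ (Suc k * i)"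
          using mult_le_mono2[OF 3, of "Suc k"] by (rule le_imp_power_dvd)
        also have "\<dots> dvd of_nat (p choose i) * (int p ^ Suc k * d) ^ i"
          by (metis dvd_mult dvd_triv_left power_mult power_mult_distrib)
        finally show ?thesis using 3 by (simp add: cong_0_iff)
      qed (auto simp: cong_0_iff)
    qed
    finally show ?case by simp
  qed
  moreover obtain c where "int a = 1 + int p * c"
    using assms by (metis cong_iff_lin cong_int_iff cong_sym of_nat_1)
  ultimately have "[int a ^ (p ^ k) = 1] (mod int p ^ Suc k)" by simp
  then show ?thesis
    by (metis cong_int_iff of_nat_1 of_nat_power)
qed

text \<open>Raising to a power \<open>p ^ m\<close> preserves residues modulo \<open>p\<close>, so
  the congruence would give \<open>g ^ k = 1\<close> modulo \<open>p\<close>. Lifting it to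
  \<open>p ^ p\<close>, the order \<open>(p - 1) p ^ (p - 1)\<close> of \<open>g\<close> divides
  \<open>k p ^ (p - 1)\<close>, whence \<open>p - 1\<close> divides \<open>k\<close>.\<close>

lemma primroot_power_not_cong_1:
  assumes p: "prime p" and g: "residue_primroot (p ^ p) g"
    and k: "0 < k" "k < p - 1"
  shows "\<not> [(g ^ (p ^ (p - 1))) ^ k = 1] (mod p)"
proof
  have p0: "0 < p" using p prime_gt_0_nat by blast
  have fermat: "[a ^ (p ^ m) = a] (mod p)" for a m
  proof (induction m)
    case (Suc m)
    have "[b ^ p = b] (mod p)" for b
    proof (cases "p dvd b")
      case True
      then show ?thesis using p0 by (metis cong_0_iff cong_pow cong_sym cong_trans power_0_left neq0_conv)
    next
      case False
      then have "[b ^ (p - 1) * b = 1 * b] (mod p)"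
        using fermat_theorem[OF p] cong_scalar_right by blast
      then show ?thesis using p0 by (simp add: power_Suc2[symmetric] del: power_Suc)
    qed
    from this[of "a ^ (p ^ m)"] Suc show ?case
      by (metis cong_trans mult.commute power_Suc power_mult)
  qed simp
  assume "[(g ^ (p ^ (p - 1))) ^ k = 1] (mod p)"
  then have "[(g ^ k) ^ (p ^ (p - 1)) = 1] (mod p)"
    by (metis mult.commute power_mult)
  then have "[g ^ k = 1] (mod p)"
    using fermat cong_sym cong_trans by blast
  then have "[(g ^ k) ^ (p ^ (p - 1)) = 1] (mod p ^ Suc (p - 1))"
    by (rule cong_prime_power_imp_cong_1)
  then have "ord (p ^ p) g dvd k * p ^ (p - 1)"
    using p0 by (metis Suc_diff_1 ord_divides power_mult)
  moreover have "ord (p ^ p) g = (p - 1) * p ^ (p - 1)"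
    using g p p0 by (simp add: residue_primroot_def totient_prime_power mult.commute)
  ultimately have "p - 1 dvd k" using p0 by simp
  then show False using k by (simp add: nat_dvd_not_less)
qed

lemma primroot_power_cong_1:
  assumes p: "prime p" and g: "residue_primroot (p ^ p) g"
  shows "[(g ^ (p ^ (p - 1))) ^ (p - 1) = 1] (mod p ^ p)"
proof -
  have "ord (p ^ p) g = p ^ (p - 1) * (p - 1)"
    using g p prime_gt_0_nat by (simp add: residue_primroot_def totient_prime_power)
  then show ?thesis
    by (metis dvd_refl ord_divides power_mult)
qed

text \<open>A discrete Fourier projection: a part of degree \<open>k\<close> is multiplied by the
  sum of the \<open>\<xi> ^ (i (k - 1))\<close>, which for \<open>p > 2\<close> is
  \<open>p - 1\<close> if \<open>k = 1\<close> and 0 for the other \<open>k < p\<close>. The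
  exponent \<open>p - 1 - i\<close> stands for \<open>- i\<close>.\<close>

definition average :: "nat \<Rightarrow> nat \<Rightarrow> ('b::ab_group_add \<Rightarrow> 'a::ab_group_add) \<Rightarrow> 'b \<Rightarrow> 'a" where
  "average p \<xi> f x = (\<Sum>i<p - 1. gmult (\<xi> ^ (p - 1 - i)) (f (gmult (\<xi> ^ i) x)))"

lemma average_add: "average p \<xi> (\<lambda>x. f x + g x) x = average p \<xi> f x + average p \<xi> g x"
  by (simp add: average_def gmult_add_right sum.distrib)

lemma average_diff: "average p \<xi> (\<lambda>x. f x - g x) x = average p \<xi> f x - average p \<xi> g x"
  by (simp add: average_def gmult_diff sum_subtractf)

lemma average_additive: "additive T \<Longrightarrow> T (average p \<xi> f x) = average p \<xi> (\<lambda>x. T (f x)) x"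
  by (simp add: average_def additive.sum gmult_additive)

lemma average_commute:
  "average p \<xi> (\<lambda>u. average p \<xi> (\<lambda>v. f u v) y) x = average p \<xi> (\<lambda>v. average p \<xi> (\<lambda>u. f u v) x) y"
  unfolding average_def gmult_sum
  by (subst sum.swap) (simp add: gmult_commute)

lemma graded_average:
  assumes "graded p k j f"
  shows "graded p k j (average q \<xi> f)"
proof -
  have "graded p k j (\<lambda>x. f (gmult m x))" for m
    using graded_comp_affine[OF _ assms, of "gmult m" 0]
    by (simp add: additive.intro gmult_add_right)
  then show ?thesis
    unfolding average_def[abs_def] by (intro graded_sum graded_gmult)
qed

section \<open>Extraction of the linear part by averaging\<close>

locale teichmueller_unit =
  fixes p n \<xi> :: nat
  assumes p: "prime p" and big: "n + 1 < p"
    and root: "[\<xi> ^ (p - 1) = 1] (mod p ^ n)"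
    and prim: "\<And>k. 0 < k \<Longrightarrow> k < p - 1 \<Longrightarrow> \<not> [\<xi> ^ k = 1] (mod p)"
    and unit: "\<not> p dvd \<xi>"
begin

lemma gmult_root:
  assumes "\<And>x :: 'a :: ab_group_add. gmult (p ^ n) x = 0"
  shows "gmult (\<xi> ^ (p - 1)) x = (x :: 'a)"
proof -
  have "p ^ n dvd \<xi> ^ (p - 1) - 1"
    using root cong_altdef_nat by (metis cong_to_1_nat)
  then obtain c where "\<xi> ^ (p - 1) = p ^ n * c + 1"
    using unit p by (metis dvd_0_right dvdE le_add_diff_inverse2 less_one not_le power_eq_0_iff)
  then show ?thesis
    by (simp add: gmult_add_left gmult_mult assms del: add_Suc_right)
qed

text \<open>Replacing \<open>x\<close> by \<open>\<xi> x\<close> shifts the summation index by one,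
  and the sum is cyclic because \<open>\<xi> ^ (p - 1)\<close> acts as the identity.\<close>

lemma average_homogeneous:
  fixes f :: "'b::ab_group_add \<Rightarrow> 'a::ab_group_add"
  assumes "\<And>x :: 'a. gmult (p ^ n) x = 0" "\<And>x :: 'b. gmult (p ^ n) x = 0"
  shows "average p \<xi> f (gmult \<xi> x) = gmult \<xi> (average p \<xi> f x)"
proof -
  \<comment> \<open>The exponent \<open>p - i\<close> is chosen so that \<open>h (i + 1)\<close> is
    a summand of the left side and \<open>h i\<close> one of the right side; the two sums then
    differ only by \<open>h (p - 1)\<close> and \<open>h 0\<close>.\<close>
  define h where "h = (\<lambda>i. gmult (\<xi> ^ (p - i)) (f (gmult (\<xi> ^ i) x)))"
  have p0: "p - 1 > 0" "Suc (p - 1) = p" using big by auto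
  have "h (p - 1) = gmult \<xi> (f x)"
    using p0 gmult_root[OF assms(2)] by (simp add: h_def Suc_diff_le)
  moreover have "h 0 = gmult \<xi> (f x)"
    using gmult_root[OF assms(1)] p0 by (metis (no_types) h_def diff_zero gmult_1 gmult_mult power_0 power_Suc One_nat_def)
  ultimately have "(\<Sum>i<p - 1. h (Suc i)) = (\<Sum>i<p - 1. h i)"
    using sum.lessThan_Suc_shift[of h "p - 1"] sum.lessThan_Suc[of h "p - 1"] by (simp add: add.commute)
  moreover have "average p \<xi> f (gmult \<xi> x) = (\<Sum>i<p - 1. h (Suc i))"
    unfolding average_def h_def by (simp add: mult.commute flip: gmult_mult)
  moreover have "gmult \<xi> (average p \<xi> f x) = (\<Sum>i<p - 1. h i)"
    unfolding average_def gmult_sum h_def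
  proof (intro sum.cong refl)
    fix i assume "i \<in> {..<p - 1}"
    then have "p - i = Suc (p - 1 - i)" by auto
    then show "gmult \<xi> (gmult (\<xi> ^ (p - 1 - i)) (f (gmult (\<xi> ^ i) x)))
        = gmult (\<xi> ^ (p - i)) (f (gmult (\<xi> ^ i) x))"
      by (simp flip: gmult_mult)
  qed
  ultimately show ?thesis by simp
qed

text \<open>The differences of order \<open>n\<close> lie in \<open>p ^ n A = 0\<close>, so
  \<open>homogeneous_imp_additive\<close> applies with \<open>m = \<xi>\<close> and
  \<open>d = n\<close>. The exponents \<open>k < n\<close> stay below \<open>p - 1\<close> because
  \<open>n + 1 < p\<close>.\<close>

lemma additive_average:
  fixes f :: "'b::ab_group_add \<Rightarrow> 'a::ab_group_add"
  assumes "\<And>x :: 'a. gmult (p ^ n) x = 0" "\<And>x :: 'b. gmult (p ^ n) x = 0"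
    and f: "graded p n 0 f"
  shows "additive (average p \<xi> f)"
proof (cases "n = 0")
  \<comment> \<open>Here \<open>p = 2\<close> is possible, and then \<open>p\<close> divides
    \<open>\<xi> - 1\<close>; but the target group is trivial.\<close>
  case True
  then have "x = 0" for x :: 'a using assms(1)[of x] by simp
  then show ?thesis by (intro additive.intro) metis
next
  case False
  have van: "fdiffs hs (average p \<xi> f) x = 0" if "length hs = n" for hs x
    using graded_fdiffs[of p hs 0 "average p \<xi> f" x] graded_average[OF f] that assms(1)
    by (auto simp: multiples_def)
  have \<xi>: "\<xi> > 0" using unit by (cases "\<xi> = 0") auto
  have ndvd: "\<not> p dvd \<xi> ^ k - 1" if "0 < k" "k < p - 1" for k
    using prim[OF that] \<xi> by (simp add: cong_altdef_nat Suc_leI)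
  show ?thesis
  proof (rule homogeneous_imp_additive[OF p assms(1) average_homogeneous[OF assms(1,2)] van \<xi> unit])
    show "\<not> p dvd \<xi> - 1" using ndvd[of 1] False big by simp
  qed (use ndvd big in auto)
qed

text \<open>The bilinear expression \<open>T u (g v)\<close> vanishes on both coordinate axes, so its average, being
  jointly additive in \<open>(u, v)\<close>, is zero on the diagonal as well.\<close>

lemma average_apply_eq_0:
  fixes g :: "'b::ab_group_add \<Rightarrow> 'a::ab_group_add" and T :: "'b \<Rightarrow> 'a \<Rightarrow> 'c::ab_group_add"
  assumes "\<And>x :: 'c. gmult (p ^ n) x = 0" "\<And>x :: 'b. gmult (p ^ n) x = 0"
    and T: "\<And>x. additive (T x)" "\<And>y. graded p n 0 (\<lambda>x. T x y)" "\<And>y. T 0 y = 0"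
    and g: "graded p n 0 g" "g 0 = 0"
  shows "average p \<xi> (\<lambda>x. T x (g x)) x = 0"
proof -
  define q where "q = (\<lambda>z :: 'b \<times> 'b. T (fst z) (g (snd z)))"
  have "graded p n (0 + 0) q"
    unfolding q_def
  proof (rule graded_apply[where T = "\<lambda>z. T (fst z)" and g = "\<lambda>z. g (snd z)"])
    show "graded p n 0 (\<lambda>z :: 'b \<times> 'b. T (fst z) y)" for y
      using graded_comp_affine[OF _ T(2), of fst 0] by (simp add: additive.intro)
    show "graded p n 0 (\<lambda>z :: 'b \<times> 'b. g (snd z))"
      using graded_comp_affine[OF _ g(1), of snd 0] by (simp add: additive.intro)
  qed (rule T(1))
  then have add: "additive (average p \<xi> q)"
    by (intro additive_average) (auto simp: assms gmult_Pair zero_prod_def)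
  have "average p \<xi> (\<lambda>x. T x (g x)) x = average p \<xi> q (x, x)"
    by (simp add: average_def q_def gmult_Pair)
  also have "\<dots> = average p \<xi> q (x, 0) + average p \<xi> q (0, x)"
    using additive.add[OF add, of "(x, 0)" "(0, x)"] by simp
  also have "\<dots> = 0"
    by (simp add: average_def q_def gmult_Pair T(3) g(2) additive.zero[OF T(1)])
  finally show ?thesis .
qed

end

section \<open>Left braces of prime power order\<close>

text \<open>Orbit sizes are powers of \<open>p\<close>. If \<open>x\<close> were the only fixed
  point, all orbits but \<open>{x}\<close> would have size divisible by \<open>p\<close>, and
  \<open>card E\<close> would be 1 modulo \<open>p\<close>.\<close>

lemma (in group_action) p_group_fixed_point:
  assumes p: "prime p" and G: "order G = p ^ n" and E: "finite E" "p dvd card E"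
    and x: "x \<in> E" "\<And>g. g \<in> carrier G \<Longrightarrow> \<phi> g x = x"
  shows "\<exists>y\<in>E. y \<noteq> x \<and> (\<forall>g\<in>carrier G. \<phi> g y = y)"
proof (rule ccontr)
  assume contra: "\<not> ?thesis"
  have part: "partition E (orbits G E \<phi>)" by (rule orbit_partition)
  have un: "E = \<Union> (orbits G E \<phi>)"
    using partition.partition_coverture[OF part] by simp
  have disj: "pairwise disjnt (orbits G E \<phi>)"
  proof (intro pairwiseI)
    fix A B assume AB: "A \<in> orbits G E \<phi>" "B \<in> orbits G E \<phi>" "A \<noteq> B"
    show "disjnt A B"
    proof (rule ccontr)
      assume "\<not> disjnt A B"
      then obtain z where z: "z \<in> A" "z \<in> B" by (auto simp: disjnt_def)
      then have "z \<in> E" using un AB by blast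
      then show False using partition.unique_class[OF part] z AB by blast
    qed
  qed
  have ox: "orbit G \<phi> x = {x}"
    using x(2) orbit_refl[OF x(1)] by (auto simp: orbit_def)
  have "p dvd card B" if B: "B \<in> orbits G E \<phi> - {{x}}" for B
  proof -
    obtain y where y: "y \<in> E" "B = orbit G \<phi> y"
      using B by (auto simp: orbits_def)
    have "y \<noteq> x" using B y ox by auto
    then obtain g where g: "g \<in> carrier G" "\<phi> g y \<noteq> y" using contra y by blast
    have "card B dvd p ^ n"
      using orbit_stabilizer_theorem[OF y(1)] G y(2) by (metis dvd_triv_left)
    then obtain k where k: "card B = p ^ k"
      using p divides_primepow_nat by blast
    have "{y, \<phi> g y} \<subseteq> B"
      using orbit_refl[OF y(1)] g y(2) by (auto simp: orbit_def)
    moreover have "finite B"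
      using un E(1) B by (metis DiffD1 Union_upper finite_subset)
    ultimately have "card B \<ge> 2"
      using card_mono[of B "{y, \<phi> g y}"] g(2) by simp
    then show ?thesis using k by (cases k) auto
  qed
  then have "p dvd (\<Sum>B\<in>orbits G E \<phi> - {{x}}. card B)"
    by (intro dvd_sum) auto
  moreover have "card E = (\<Sum>B\<in>orbits G E \<phi>. card B)"
    using card_Union_disjoint[OF disj] un E(1) by (metis Union_upper finite_subset)
  moreover have "(\<Sum>B\<in>orbits G E \<phi>. card B) = 1 + (\<Sum>B\<in>orbits G E \<phi> - {{x}}. card B)"
  proof -
    have "{x} \<in> orbits G E \<phi>" using ox x(1) by (force simp: orbits_def)
    moreover have "finite (orbits G E \<phi>)" using un E(1) by (metis finite_UnionD)
    ultimately show ?thesis by (simp add: sum.remove)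
  qed
  ultimately have "p dvd 1" using E(2) by (metis dvd_add_left_iff)
  then show False using p by simp
qed

text \<open>Absorption: \<open>k\<close> times the coefficient is a multiple of
  \<open>p ^ j\<close>, and \<open>k\<close> is prime to \<open>p\<close>.\<close>

lemma prime_power_dvd_choose:
  assumes "prime p" "0 < k" "k < p"
  shows "p ^ j dvd (p ^ j choose k)"
proof -
  have "k * (p ^ j choose k) = p ^ j * (p ^ j - 1 choose (k - 1))"
    using binomial_absorption[of "k - 1" "p ^ j"] assms(2) by simp
  moreover have "coprime (p ^ j) k"
    using assms by (simp add: nat_dvd_not_less prime_imp_coprime)
  ultimately show ?thesis
    by (metis coprime_dvd_mult_right_iff dvd_triv_left)
qed

section \<open>The lambda action, circle powers and the socle series\<close>

locale brace =
  fixes circ :: "'a::ab_group_add \<Rightarrow> 'a \<Rightarrow> 'a"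
  assumes left_brace: "left_brace circ"
begin

abbreviation star :: "'a \<Rightarrow> 'a \<Rightarrow> 'a" where
  "star \<equiv> brace_star circ"

definition lam :: "'a \<Rightarrow> 'a \<Rightarrow> 'a" where
  "lam a b = circ a b - a"

definition cinv :: "'a \<Rightarrow> 'a" where
  "cinv a = (SOME b. circ b a = 0 \<and> circ a b = 0)"

primrec cpow :: "'a \<Rightarrow> nat \<Rightarrow> 'a" where
  "cpow a 0 = 0"
| "cpow a (Suc m) = circ a (cpow a m)"

lemma circ_assoc: "circ (circ a b) c = circ a (circ b c)"
  using left_brace unfolding left_brace_def by blast

lemma circ_distrib: "circ a (b + c) + a = circ a b + circ a c"
  using left_brace unfolding left_brace_def by blast

lemma circ_0_right [simp]: "circ a 0 = a"
  using circ_distrib[of a 0 0] by simp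

text \<open>Since \<open>circ a 0 = a\<close> for all \<open>a\<close>, the neutral element of the
  circle group must be 0.\<close>

lemma circ_0_left_and_inverse: "circ 0 a = a \<and> (\<exists>b. circ b a = 0 \<and> circ a b = 0)"
proof -
  obtain e where e: "\<forall>a. circ e a = a \<and> circ a e = a" "\<forall>a. \<exists>b. circ b a = e \<and> circ a b = e"
    using left_brace unfolding left_brace_def by blast
  have "e = 0" using e(1) circ_0_right by metis
  then show ?thesis using e by blast
qed

lemma circ_0_left [simp]: "circ 0 a = a"
  using circ_0_left_and_inverse by blast

lemma circ_cinv [simp]: "circ (cinv a) a = 0" "circ a (cinv a) = 0"
  using someI_ex[of "\<lambda>b. circ b a = 0 \<and> circ a b = 0"] circ_0_left_and_inverse
  unfolding cinv_def by blast+

lemma circ_eq: "circ a b = a + lam a b"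
  by (simp add: lam_def)

lemma lam_eq: "lam a b = b + star a b"
  by (simp add: lam_def brace_star_def)

lemma additive_lam: "additive (lam a)"
proof
  show "lam a (x + y) = lam a x + lam a y" for x y
    using circ_distrib[of a x y] by (simp add: lam_def algebra_simps)
qed

lemma additive_star: "additive (star a)"
  using additive.add[OF additive_lam] by (intro additive.intro) (simp add: lam_eq)

lemma lam_circ: "lam (circ a b) c = lam a (lam b c)"
proof -
  have "circ a (circ b c - b) + circ a b = circ a (circ b c) + a"
    using circ_distrib[of a "circ b c - b" b] by simp
  then show ?thesis by (simp add: lam_def circ_assoc algebra_simps)
qed

lemma lam_0 [simp]: "lam 0 b = b"
  by (simp add: lam_def)

lemma star_0 [simp]: "star 0 b = 0"
  by (simp add: brace_star_def)

lemma lam_cinv [simp]: "lam (cinv a) (lam a b) = b" "lam a (lam (cinv a) b) = b"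
  by (simp_all flip: lam_circ)

lemma star_circ: "star (circ a b) c = star a c + star b c + star a (star b c)"
  using lam_circ[of a b c] by (simp add: lam_eq additive.add[OF additive_star] algebra_simps)

lemma circ_lam_cinv: "circ a (lam (cinv a) d) = a + d"
  by (simp add: circ_eq)

text \<open>Writing \<open>a + d\<close> as a circle product makes \<open>star_circ\<close>
  applicable. This controls increments of the first argument, in which \<open>star\<close> is not
  additive.\<close>

lemma star_add: "star (a + d) c = star a c + lam a (star (lam (cinv a) d) c)"
  using star_circ[of a "lam (cinv a) d" c] by (simp add: circ_lam_cinv lam_eq[of a "star (lam (cinv a) d) c"])

lemma cpow_0_left [simp]: "cpow 0 m = 0"
  by (induction m) simp_all

lemma additive_star_funpow: "additive (star a ^^ k)"
proof (induction k)
  case (Suc k)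
  then show ?case
    using additive.add[OF additive_star] by (auto intro!: additive.intro simp: additive.add)
qed (simp add: additive.intro)

text \<open>\<open>lam a\<close> is the identity plus \<open>star a\<close>; this is the binomial
  theorem for its \<open>m\<close>-th power.\<close>

lemma lam_cpow: "lam (cpow a m) v = (\<Sum>k\<le>m. gmult (m choose k) ((star a ^^ k) v))"
proof (induction m arbitrary: v)
  case (Suc m)
  define x where "x = (\<lambda>k. (star a ^^ k) v)"
  have "lam (cpow a (Suc m)) v = lam a (\<Sum>k\<le>m. gmult (m choose k) (x k))"
    by (simp add: lam_circ Suc x_def)
  also have "\<dots> = (\<Sum>k\<le>m. gmult (m choose k) (x k)) + (\<Sum>k\<le>m. gmult (m choose k) (x (Suc k)))"
    by (simp add: lam_eq x_def additive.sum[OF additive_star] gmult_additive[OF additive_star])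
  also have "(\<Sum>k\<le>m. gmult (m choose k) (x k)) = (\<Sum>k\<le>Suc m. gmult (m choose k) (x k))"
    by (simp add: binomial_eq_0)
  also have "\<dots> = x 0 + (\<Sum>k\<le>m. gmult (m choose Suc k) (x (Suc k)))"
    by (subst sum.atMost_Suc_shift) simp
  finally show ?case
    by (subst sum.atMost_Suc_shift) (simp add: x_def gmult_add_left sum.distrib algebra_simps)
qed simp

text \<open>With \<open>S = star a\<close>, the circle power is the sum of the
  \<open>(1 + S) ^ i\<close> at \<open>a\<close> for \<open>i < m\<close>, formally
  \<open>((1 + S) ^ m - 1) / S\<close>.\<close>

lemma cpow_eq: "cpow a m = (\<Sum>k<m. gmult (m choose Suc k) ((star a ^^ k) a))"
proof (induction m)
  case (Suc m)
  define x where "x = (\<lambda>k. (star a ^^ k) a)"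
  have "cpow a (Suc m) = x 0 + (\<Sum>k<m. gmult (m choose Suc k) (x (Suc k)))
      + (\<Sum>k<m. gmult (m choose Suc k) (x k))"
  proof -
    have "cpow a (Suc m) = a + (cpow a m + star a (cpow a m))"
      by (simp add: circ_eq[of a "cpow a m"] lam_eq[of a "cpow a m"])
    then show ?thesis
      by (simp add: Suc x_def additive.sum[OF additive_star] gmult_additive[OF additive_star] algebra_simps)
  qed
  also have "x 0 + (\<Sum>k<m. gmult (m choose Suc k) (x (Suc k))) = (\<Sum>k<Suc m. gmult (m choose k) (x k))"
    by (subst sum.lessThan_Suc_shift) simp
  also have "(\<Sum>k<m. gmult (m choose Suc k) (x k)) = (\<Sum>k<Suc m. gmult (m choose Suc k) (x k))"
    by (simp add: binomial_eq_0)
  finally show ?case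
    by (simp only: sum.distrib[symmetric] gmult_add_left[symmetric] binomial_Suc_Suc[symmetric] x_def)
qed simp

text \<open>Level \<open>m\<close> consists of the elements killed by any \<open>m\<close>
  successive left stars. Modulo level \<open>m\<close>, the next level is the set of fixed points of
  the lambda action.\<close>

primrec socle :: "nat \<Rightarrow> 'a set" where
  "socle 0 = {0}"
| "socle (Suc m) = {v. \<forall>a. star a v \<in> socle m}"

lemma socle_subgroup:
  "0 \<in> socle m" "x \<in> socle m \<Longrightarrow> y \<in> socle m \<Longrightarrow> x + y \<in> socle m"
  "x \<in> socle m \<Longrightarrow> - x \<in> socle m"
  by (induction m arbitrary: x y)
    (auto simp: additive.zero[OF additive_star] additive.add[OF additive_star] additive.minus[OF additive_star])

lemma socle_mono: "socle m \<subseteq> socle (Suc m)"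
  by (induction m) (auto simp: additive.zero[OF additive_star])

lemma star_socle: "v \<in> socle m \<Longrightarrow> star a v \<in> socle m"
  using socle_mono[of m] by auto

lemma lam_socle: "v \<in> socle m \<Longrightarrow> lam a v \<in> socle m"
  by (simp add: lam_eq socle_subgroup star_socle)

lemma star_funpow_socle: "v \<in> socle (Suc m) \<Longrightarrow> 0 < k \<Longrightarrow> (star a ^^ k) v \<in> socle m"
proof (induction k)
  case (Suc k)
  then show ?case by (cases "k = 0") (auto intro: star_socle)
qed simp

lemma star_funpow_socle_eq_0: "v \<in> socle m \<Longrightarrow> (star a ^^ m) v = 0"
  by (induction m arbitrary: v) (auto simp del: funpow.simps simp: funpow_Suc_right)

end

section \<open>Nilpotency and prime power multiples in order \<open>p ^ n\<close>\<close>

locale p_brace = brace circ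
  for circ :: "'a::{ab_group_add,finite} \<Rightarrow> 'a \<Rightarrow> 'a" +
  fixes p n :: nat
  assumes p: "prime p" and card: "card (UNIV :: 'a set) = p ^ n" and big: "n + 1 < p"
begin

lemma torsion: "gmult (p ^ n) (a :: 'a) = 0"
  using gmult_card_UNIV[of a] card by simp

lemma card_cosets:
  assumes "0 \<in> Z" "\<And>x y. x \<in> Z \<Longrightarrow> y \<in> Z \<Longrightarrow> x + y \<in> Z" "\<And>x. x \<in> Z \<Longrightarrow> - x \<in> (Z :: 'a set)"
  shows "card (range (\<lambda>v. (+) v ` Z)) * card Z = p ^ n"
proof -
  define H where "H = \<lparr>carrier = (UNIV :: 'a set), monoid.mult = ((+) :: 'a \<Rightarrow> 'a \<Rightarrow> 'a), one = (0 :: 'a)\<rparr>"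
  have H: "group H"
  proof (rule groupI)
    show "\<exists>y\<in>carrier H. y \<otimes>\<^bsub>H\<^esub> x = \<one>\<^bsub>H\<^esub>" for x
      by (rule bexI[of _ "- x"]) (auto simp: H_def)
  qed (auto simp: H_def add.assoc)
  have "inv\<^bsub>H\<^esub> x = - x" for x
    by (rule group.inv_equality[OF H]) (auto simp: H_def)
  then have "subgroup Z H"
    using assms by (intro subgroup.intro) (auto simp: H_def)
  moreover have "rcosets\<^bsub>H\<^esub> Z = range (\<lambda>v. (+) v ` Z)"
    by (auto simp: RCOSETS_def r_coset_def H_def image_def add.commute)
  ultimately show ?thesis
    using group.lagrange[OF H, of Z] card by (simp add: order_def H_def)
qed

text \<open>The circle group is a \<open>p\<close>-group acting through \<open>lam\<close> on the
  cosets of \<open>Z\<close>, whose number is divisible by \<open>p\<close>. As \<open>Z\<close>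
  itself is fixed, so is another coset; the coset of \<open>v\<close> is fixed by \<open>a\<close>
  exactly when \<open>star a v\<close> lies in \<open>Z\<close>.\<close>

lemma ex_fixed_modulo:
  assumes Z: "0 \<in> Z" "\<And>x y. x \<in> Z \<Longrightarrow> y \<in> Z \<Longrightarrow> x + y \<in> Z" "\<And>x. x \<in> Z \<Longrightarrow> - x \<in> (Z :: 'a set)"
    and inv: "\<And>a v. v \<in> Z \<Longrightarrow> lam a v \<in> Z" and ne: "Z \<noteq> UNIV"
  shows "\<exists>v. v \<notin> Z \<and> (\<forall>a. star a v \<in> Z)"
proof -
  define C where "C = (\<lambda>v. (+) v ` Z)"
  define G where "G = \<lparr>carrier = (UNIV :: 'a set), monoid.mult = circ, one = 0\<rparr>"
  define \<phi> where "\<phi> = (\<lambda>a. \<lambda>S\<in>range C. lam a ` S)"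
  have C_eq: "C v = C w \<longleftrightarrow> v - w \<in> Z" for v w
  proof
    assume "C v = C w"
    then have "v \<in> C w" using Z(1) by (force simp: C_def)
    then show "v - w \<in> Z" by (auto simp: C_def)
  next
    assume d: "v - w \<in> Z"
    show "C v = C w"
    proof (intro equalityI subsetI)
      fix x assume "x \<in> C v"
      then obtain z where "z \<in> Z" "x = v + z" by (auto simp: C_def)
      then have "x = w + ((v - w) + z)" "(v - w) + z \<in> Z" using Z(2) d by auto
      then show "x \<in> C w" unfolding C_def by blast
    next
      fix x assume "x \<in> C w"
      then obtain z where "z \<in> Z" "x = w + z" by (auto simp: C_def)
      then have "x = v + (- (v - w) + z)" "- (v - w) + z \<in> Z"
        using Z(2)[OF Z(3)[OF d]] by simp_all
      then show "x \<in> C v" unfolding C_def by blast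
    qed
  qed
  have lamZ: "lam a ` Z = Z" for a
  proof (intro equalityI subsetI)
    fix z assume "z \<in> Z"
    then show "z \<in> lam a ` Z" using inv[of z "cinv a"] by (intro image_eqI[of _ _ "lam (cinv a) z"]) auto
  qed (use inv in auto)
  have lamC: "lam a ` C v = C (lam a v)" for a v
  proof -
    have "lam a ` C v = (+) (lam a v) ` (lam a ` Z)"
      by (simp add: C_def image_image additive.add[OF additive_lam])
    then show ?thesis by (simp add: lamZ C_def)
  qed
  have \<phi>C: "\<phi> a (C v) = C (lam a v)" for a v
    by (simp add: \<phi>_def lamC)
  have G: "group G"
  proof (rule groupI)
    show "\<exists>y\<in>carrier G. y \<otimes>\<^bsub>G\<^esub> x = \<one>\<^bsub>G\<^esub>" for x
      by (rule bexI[of _ "cinv x"]) (auto simp: G_def)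
  qed (auto simp: G_def circ_assoc)
  have "group_hom G (BijGroup (range C)) \<phi>"
  proof (rule group_hom.intro[OF G group_BijGroup], rule group_hom_axioms.intro, rule homI)
    show bij: "\<phi> a \<in> carrier (BijGroup (range C))" for a
    proof -
      have "bij_betw (\<phi> a) (range C) (range C)"
        by (rule bij_betw_byWitness[where f' = "\<phi> (cinv a)"]) (auto simp: \<phi>C)
      then show ?thesis
        by (simp add: BijGroup_def Bij_def) (simp add: \<phi>_def)
    qed
    show "\<phi> (a \<otimes>\<^bsub>G\<^esub> b) = \<phi> a \<otimes>\<^bsub>BijGroup (range C)\<^esub> \<phi> b" for a b
      using bij[of a] bij[of b]
      by (auto simp: BijGroup_def fun_eq_iff compose_def restrict_def \<phi>C G_def lam_circ)
         (auto simp: \<phi>_def)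
  qed
  then interpret group_action G "range C" \<phi> by (rule group_action.intro)
  have cc: "card (range C) * card Z = p ^ n"
    unfolding C_def by (rule card_cosets[OF Z])
  then obtain k where k: "card (range C) = p ^ k"
    using divides_primepow_nat[OF p] dvd_triv_left by metis
  have "card Z \<noteq> p ^ n"
    using ne card_subset_eq[of UNIV Z] card by auto
  then have "p dvd card (range C)" using cc k by (cases k) auto
  moreover have "order G = p ^ n" by (simp add: G_def order_def card)
  moreover have "\<phi> a (C 0) = C 0" for a by (simp add: \<phi>C additive.zero[OF additive_lam])
  ultimately obtain v where v: "C v \<noteq> C 0" "\<And>a. \<phi> a (C v) = C v"
    using p_group_fixed_point[of p n "C 0"] p by (auto simp: G_def)
  have "lam a v - v \<in> Z" for a using v(2)[of a] by (simp add: \<phi>C C_eq)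
  then show ?thesis using v(1) C_eq[of v 0] by (auto simp: lam_eq)
qed

text \<open>While a level is proper, the next one is strictly larger, and both orders are powers of
  \<open>p\<close>; hence \<open>n\<close> steps exhaust the \<open>p ^ n\<close> elements.\<close>

lemma socle_eq_UNIV: "socle n = UNIV"
proof -
  have "p ^ m \<le> card (socle m) \<or> socle m = UNIV" for m
  proof (induction m)
    case (Suc m)
    show ?case
    proof (cases "socle m = UNIV")
      case True
      then show ?thesis using socle_mono[of m] by blast
    next
      case False
      obtain v where "v \<notin> socle m" "\<forall>a. star a v \<in> socle m"
        using ex_fixed_modulo[OF socle_subgroup lam_socle False] by blast
      then have "socle m \<subset> socle (Suc m)" using socle_mono[of m] by auto
      then have less: "card (socle m) < card (socle (Suc m))" by (intro psubset_card_mono) auto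
      have pow: "\<exists>k. card (socle j) = p ^ k" for j
        using divides_primepow_nat[OF p] card_cosets[OF socle_subgroup] dvd_triv_right by metis
      obtain k l where kl: "card (socle m) = p ^ k" "card (socle (Suc m)) = p ^ l"
        using pow by blast
      have p1: "p > 1" using p prime_gt_1_nat by blast
      have "m \<le> k" using Suc False kl(1) p1 by (metis power_increasing_iff)
      moreover have "k < l" using less kl p1 by simp
      ultimately show ?thesis using kl p1 by (simp add: power_increasing_iff Suc_le_eq del: power_Suc)
    qed
  qed simp
  then consider "p ^ n \<le> card (socle n)" | "socle n = UNIV" by blast
  then show ?thesis
  proof cases
    case 1
    then have "card (socle n) = card (UNIV :: 'a set)"
      using card card_mono[of UNIV "socle n"] by simp
    then show ?thesis by (intro card_subset_eq) auto
  qed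
qed

lemma star_funpow_eq_0: "n \<le> k \<Longrightarrow> (star a ^^ k) v = 0"
  using star_funpow_socle_eq_0[of v n a] socle_eq_UNIV additive.zero[OF additive_star_funpow]
  by (metis UNIV_I add.commute comp_apply funpow_add le_add_diff_inverse2)

text \<open>If \<open>k < n\<close>, then \<open>i \<le> n < p\<close> and \<open>p ^ j\<close>
  divides the coefficient; if \<open>k \<ge> n\<close>, nilpotency kills the term.\<close>

lemma gmult_choose_star_funpow:
  assumes "0 < i" "i \<le> Suc k"
  obtains c where "\<And>v. gmult (p ^ j choose i) ((star a ^^ k) v) = gmult (p ^ j) (gmult c ((star a ^^ k) v))"
proof (cases "n \<le> k")
  case True
  then show ?thesis using that by (simp add: star_funpow_eq_0)
next
  case False
  then have "p ^ j dvd (p ^ j choose i)"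
    using prime_power_dvd_choose[OF p] assms big by simp
  then obtain c where "(p ^ j choose i) = p ^ j * c" by (rule dvdE)
  then show ?thesis using that by (simp add: gmult_mult)
qed

lemma star_cpow:
  "star (cpow a (p ^ j)) v = (\<Sum>k\<in>{1..p ^ j}. gmult (p ^ j choose k) ((star a ^^ k) v))"
proof -
  have "{..p ^ j} = insert 0 {1..p ^ j}" by auto
  then have "lam (cpow a (p ^ j)) v = v + (\<Sum>k\<in>{1..p ^ j}. gmult (p ^ j choose k) ((star a ^^ k) v))"
    by (simp add: lam_cpow)
  then show ?thesis by (simp add: lam_eq)
qed

lemma star_cpow_multiples: "star (cpow a (p ^ j)) v \<in> multiples (p ^ j)"
  unfolding star_cpow
proof (rule multiples_sum)
  fix k assume "k \<in> {1..p ^ j}"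
  then have "0 < k" "k \<le> Suc k" by auto
  then obtain c where "gmult (p ^ j choose k) ((star a ^^ k) v) = gmult (p ^ j) (gmult c ((star a ^^ k) v))"
    using gmult_choose_star_funpow by metis
  then show "gmult (p ^ j choose k) ((star a ^^ k) v) \<in> multiples (p ^ j)" by simp
qed

lemma star_cpow_eq_0:
  assumes "gmult (p ^ j) v = 0"
  shows "star (cpow a (p ^ j)) v = 0"
  unfolding star_cpow
proof (rule sum.neutral, rule ballI)
  fix k assume "k \<in> {1..p ^ j}"
  then have "0 < k" "k \<le> Suc k" by auto
  then obtain c where "gmult (p ^ j choose k) ((star a ^^ k) v) = gmult (p ^ j) (gmult c ((star a ^^ k) v))"
    using gmult_choose_star_funpow by metis
  also have "\<dots> = gmult c ((star a ^^ k) (gmult (p ^ j) v))"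
    by (simp add: gmult_commute gmult_additive[OF additive_star_funpow])
  finally show "gmult (p ^ j choose k) ((star a ^^ k) v) = 0"
    by (simp add: assms additive.zero[OF additive_star_funpow])
qed

text \<open>By successive approximation: \<open>p ^ j a\<close> and the \<open>p ^ j\<close>-th power of \<open>a\<close> in the circle
  group differ by a factor \<open>p ^ j b\<close> with \<open>b\<close> one step deeper in the socle series.\<close>

lemma gmult_prime_power_induct:
  assumes circ: "\<And>a b. P a \<Longrightarrow> P b \<Longrightarrow> P (circ a b)" and pow: "\<And>a. P (cpow a (p ^ j))"
  shows "P (gmult (p ^ j) a)"
proof -
  have "P (gmult (p ^ j) a)" if "a \<in> socle m" for m
    using that
  proof (induction m arbitrary: a)
    case 0
    then show ?case using pow[of 0] by simp
  next
    case (Suc m)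
    have "\<exists>c. gmult (p ^ j choose Suc k) ((star a ^^ k) a) = gmult (p ^ j) (gmult c ((star a ^^ k) a))" for k
      using gmult_choose_star_funpow[of "Suc k" k j a] by (metis le_refl zero_less_Suc)
    then obtain c where c: "\<And>k. gmult (p ^ j choose Suc k) ((star a ^^ k) a)
        = gmult (p ^ j) (gmult (c k) ((star a ^^ k) a))"
      by metis
    define s where "s = (\<Sum>k\<in>{1..<p ^ j}. gmult (c k) ((star a ^^ k) a))"
    have gm: "gmult i v \<in> socle m" if "v \<in> socle m" for i v
      using that by (induction i) (auto simp: gmult_Suc socle_subgroup)
    have sumsoc: "sum f S \<in> socle m" if "\<And>i. i \<in> S \<Longrightarrow> f i \<in> socle m" for f and S :: "nat set"
      using that by (induction S rule: infinite_finite_induct) (auto simp: socle_subgroup)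
    have s: "s \<in> socle m"
      unfolding s_def by (intro sumsoc gm star_funpow_socle[OF Suc.prems]) auto
    have "p ^ j > 0" using p prime_gt_0_nat by simp
    \<comment> \<open>The term \<open>k = 0\<close> is \<open>p ^ j a\<close>. All others contain a
      star and so lie one socle level deeper.\<close>
    then have "{..<p ^ j} = insert 0 {1..<p ^ j}" by auto
    then have "cpow a (p ^ j) = gmult (p ^ j) a + (\<Sum>k\<in>{1..<p ^ j}. gmult (p ^ j choose Suc k) ((star a ^^ k) a))"
      by (simp add: cpow_eq)
    also have "\<dots> = gmult (p ^ j) (a + s)"
      by (simp only: c s_def gmult_sum gmult_add_right)
    finally have eq: "cpow a (p ^ j) = gmult (p ^ j) (a + s)" .
    \<comment> \<open>Chosen so that \<open>lam\<close> of the circle power sends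
      \<open>p ^ j b\<close> to \<open>- p ^ j s\<close>, which cancels the error term.\<close>
    define b where "b = lam (cinv (cpow a (p ^ j))) (- s)"
    have "b \<in> socle m" unfolding b_def using s by (intro lam_socle socle_subgroup)
    then have "P (circ (cpow a (p ^ j)) (gmult (p ^ j) b))"
      by (intro circ pow Suc.IH)
    also have "circ (cpow a (p ^ j)) (gmult (p ^ j) b) = gmult (p ^ j) a"
      by (simp add: b_def circ_lam_cinv flip: gmult_additive[OF additive_lam])
         (simp add: eq flip: gmult_add_right)
    finally show ?case .
  qed
  then show ?thesis using socle_eq_UNIV by blast
qed

text \<open>Required for all \<open>y\<close> at once, the property is closed under circle products
  by \<open>star_circ\<close>, so it passes from circle powers to multiples.\<close>

lemma star_multiples:
  assumes "x \<in> multiples (p ^ j)"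
  shows "star x y \<in> multiples (p ^ j)"
proof -
  have "\<forall>y. star (gmult (p ^ j) a) y \<in> multiples (p ^ j)" for a
    by (rule gmult_prime_power_induct)
      (auto simp: star_circ intro: multiples_add star_cpow_multiples)
  then show ?thesis using assms by (auto simp: multiples_def)
qed

lemma star_gmult_eq_0:
  assumes "gmult (p ^ j) y = 0"
  shows "star (gmult (p ^ j) a) y = 0"
  by (rule gmult_prime_power_induct)
    (auto simp: star_circ star_cpow_eq_0[OF assms] additive.zero[OF additive_star])

end

section \<open>The pre-Lie product\<close>

lemma graded_le: "i \<le> j \<Longrightarrow> graded p k j f \<Longrightarrow> graded p k i f"
  by (induction rule: inc_induct) (auto intro: graded_decr)

text \<open>The grading starts at 0 although the values lie in \<open>p A\<close>: the first
  differences \<open>p h\<close> contain only one guaranteed factor \<open>p\<close>, and the second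
  differences vanish.\<close>

lemma graded_gmult_self: "graded p k 0 (gmult p)"
proof (cases k)
  case (Suc k')
  have "fdiff h (gmult p) = (\<lambda>_. gmult p h)" for h :: 'a
    by (auto simp: fdiff_def gmult_add_right)
  then show ?thesis using Suc by (cases k') (simp_all add: fdiff_def[abs_def])
qed simp

context p_brace
begin

text \<open>By \<open>star_add\<close>, a difference of \<open>star (G x) y\<close> is
  \<open>lam (G x)\<close> applied to a star whose first argument is a difference of
  \<open>G\<close> twisted by the inverse of \<open>lam (G x)\<close>. That argument is one grade
  higher, so the induction closes once the inverse maps are treated along with the star.\<close>

lemma graded_star_lam_cinv:
  fixes G :: "'b::ab_group_add \<Rightarrow> 'a"
  assumes "graded p k j G"
  shows "(\<forall>y. graded p k j (\<lambda>x. star (G x) y)) \<and> (\<forall>y. graded p k 0 (\<lambda>x. lam (cinv (G x)) y))"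
  using assms
proof (induction k arbitrary: j G)
  case 0
  then show ?case by (simp add: star_multiples)
next
  case (Suc k)
  have Gk: "graded p k j G" by (rule graded_SucD[OF Suc.prems])
  have star_k: "graded p k j (\<lambda>x. star (G x) y)" and inv_k: "graded p k 0 (\<lambda>x. lam (cinv (G x)) y)" for y
    using Suc.IH[OF Gk] by auto
  have lam_k: "graded p k 0 (\<lambda>x. lam (G x) y)" for y
    unfolding lam_eq by (intro graded_add graded_const graded_le[OF _ star_k]) simp
  have diff_star: "graded p k (Suc j) (fdiff h (\<lambda>x. star (G x) y))" for h y
  proof -
    define W where "W = (\<lambda>x. lam (cinv (G x)) (fdiff h G x))"
    have "graded p k (0 + Suc j) W"
      unfolding W_def by (rule graded_apply[OF additive_lam inv_k]) (use Suc.prems in simp)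
    then have "graded p k (Suc j) (\<lambda>x. star (W x) y)"
      using Suc.IH by simp
    then have "graded p k (0 + Suc j) (\<lambda>x. lam (G x) (star (W x) y))"
      by (rule graded_apply[OF additive_lam lam_k])
    moreover have "fdiff h (\<lambda>x. star (G x) y) = (\<lambda>x. lam (G x) (star (W x) y))"
    proof
      fix x
      show "fdiff h (\<lambda>x. star (G x) y) x = lam (G x) (star (W x) y)"
        using star_add[of "G x" "fdiff h G x" y] by (simp add: fdiff_def W_def)
    qed
    ultimately show ?thesis by simp
  qed
  have diff_inv: "graded p k (Suc 0) (fdiff h (\<lambda>x. lam (cinv (G x)) y))" for h y
  proof -
    have "graded p k (0 + Suc 0) (\<lambda>x. lam (cinv (G (x + h)))
        (star (G (x + h)) (lam (cinv (G x)) y) - star (G x) (lam (cinv (G x)) y)))"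
    proof (rule graded_apply[where T = "\<lambda>x. lam (cinv (G (x + h)))", OF additive_lam])
      show "graded p k 0 (\<lambda>x. lam (cinv (G (x + h))) y)" for y
        by (rule graded_shift[OF inv_k])
      have "graded p k (Suc 0 + 0) (\<lambda>x. (star (G (x + h)) (lam (cinv (G x)) y) - star (G x) (lam (cinv (G x)) y)))"
      proof (rule graded_apply[where T = "\<lambda>x v. star (G (x + h)) v - star (G x) v", OF _ _ inv_k])
        show "additive (\<lambda>v. star (G (x + h)) v - star (G x) v)" for x
          by (auto intro!: additive.intro simp: additive.add[OF additive_star])
        show "graded p k (Suc 0) (\<lambda>x. star (G (x + h)) v - star (G x) v)" for v
          using graded_le[OF _ diff_star[of h v], of "Suc 0"] by (simp add: fdiff_def[abs_def])
      qed
      then show "graded p k (Suc 0) (\<lambda>x. (star (G (x + h)) (lam (cinv (G x)) y) - star (G x) (lam (cinv (G x)) y)))"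
        by simp
    qed
    \<comment> \<open>The resolvent identity \<open>B'^-1 - B^-1 = - B'^-1 (B' - B) B^-1\<close>,
      where \<open>B' - B\<close> is a difference of stars.\<close>
    moreover have "fdiff h (\<lambda>x. lam (cinv (G x)) y) = (\<lambda>x. - lam (cinv (G (x + h)))
        (star (G (x + h)) (lam (cinv (G x)) y) - star (G x) (lam (cinv (G x)) y)))"
    proof
      fix x
      define v where "v = lam (cinv (G x)) y"
      have y: "y = lam (G x) v" by (simp add: v_def)
      have "star (G (x + h)) v - star (G x) v = lam (G (x + h)) v - lam (G x) v"
        by (simp add: lam_eq)
      then have "lam (cinv (G (x + h))) (star (G (x + h)) v - star (G x) v) = v - lam (cinv (G (x + h))) y"
        by (simp add: additive.diff[OF additive_lam] flip: y)
      then show "fdiff h (\<lambda>x. lam (cinv (G x)) y) x = - lam (cinv (G (x + h)))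
          (star (G (x + h)) (lam (cinv (G x)) y) - star (G x) (lam (cinv (G x)) y))"
        by (simp add: fdiff_def flip: v_def)
    qed
    ultimately show ?thesis
      by (simp add: graded_minus)
  qed
  have "graded p (Suc k) j (\<lambda>x. star (G x) y)" for y
    using diff_star graded_multiples[OF Suc.prems] star_multiples by simp
  moreover have "graded p (Suc k) 0 (\<lambda>x. lam (cinv (G x)) y)" for y
    using diff_inv by simp
  ultimately show ?case by blast
qed

definition pstar :: "'a \<Rightarrow> 'a \<Rightarrow> 'a" where
  "pstar x y = star (gmult p x) y"

lemma additive_pstar: "additive (pstar x)"
  unfolding pstar_def[abs_def] by (rule additive_star)

lemma pstar_0 [simp]: "pstar 0 y = 0"
  by (simp add: pstar_def)

lemma graded_pstar: "graded p k 0 (\<lambda>x. pstar (x + c) y)"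
  using graded_star_lam_cinv[OF graded_gmult_self, of k]
  by (intro graded_shift[where f = "\<lambda>x. pstar x y"]) (simp add: pstar_def)

text \<open>The circle product of \<open>p x\<close> and \<open>p y\<close> is again a multiple of
  \<open>p\<close>, because \<open>lam\<close> is additive; the rest is
  \<open>star_circ\<close>.\<close>

lemma pstar_circ: "pstar (x + lam (gmult p x) y) z = pstar x z + pstar y z + pstar x (pstar y z)"
proof -
  have "gmult p (x + lam (gmult p x) y) = circ (gmult p x) (gmult p y)"
    by (simp add: circ_eq gmult_add_right gmult_additive[OF additive_lam])
  then show ?thesis by (simp add: pstar_def star_circ)
qed

end

section \<open>The bilinear part of the star and its commutator identity\<close>

locale p_brace_unit = p_brace circ p n + teichmueller_unit p n \<xi>
  for circ :: "'a::{ab_group_add,finite} \<Rightarrow> 'a \<Rightarrow> 'a" and p n \<xi> :: nat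
begin

text \<open>Up to the factor \<open>p - 1\<close>, this is the derivative at \<open>x\<close> in direction \<open>u\<close> of \<open>x \<mapsto> pstar x y\<close>.\<close>

definition dpstar :: "'a \<Rightarrow> 'a \<Rightarrow> 'a \<Rightarrow> 'a" where
  "dpstar x u y = average p \<xi> (\<lambda>v. pstar (x + v) y) u"

lemma additive_dpstar: "additive (\<lambda>u. dpstar x u y)"
  unfolding dpstar_def
  by (rule additive_average[OF torsion torsion]) (use graded_pstar[of n x y] in \<open>simp add: add.commute\<close>)

text \<open>Thus \<open>dpstar 0\<close> is the bilinear map \<open>\<Lambda>\<close> of the
  overview.\<close>

lemma dpstar_0: "dpstar 0 x y = average p \<xi> (\<lambda>v. pstar v y) x"
  by (simp add: dpstar_def)

lemma additive_dpstar_0: "additive (dpstar 0 x)"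
  by (rule additive.intro)
    (simp add: dpstar_0 average_def additive.add[OF additive_pstar] gmult_add_right sum.distrib)

lemma graded_dpstar: "graded p k 0 (\<lambda>x. dpstar x u y)"
  unfolding dpstar_def average_def by (intro graded_sum graded_gmult graded_pstar)

text \<open>Replacing the derivative at \<open>x\<close> by the one at 0 costs a product of two
  factors vanishing at 0, which has no linear part. The average then passes through the additive
  \<open>dpstar 0\<close>.\<close>

lemma average_dpstar_pstar:
  "average p \<xi> (\<lambda>x. dpstar x (pstar x y) z) x = dpstar 0 (dpstar 0 x y) z"
proof -
  have "average p \<xi> (\<lambda>x. dpstar x (pstar x y) z - dpstar 0 (pstar x y) z) x = 0"
  proof (rule average_apply_eq_0[where T = "\<lambda>x u. dpstar x u z - dpstar 0 u z" and g = "\<lambda>x. pstar x y", OF torsion torsion])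
    show "additive (\<lambda>u. dpstar x u z - dpstar 0 u z)" for x
      by (rule additive.intro) (simp add: additive.add[OF additive_dpstar])
    show "graded p n 0 (\<lambda>x. dpstar x u z - dpstar 0 u z)" for u
      by (intro graded_diff graded_dpstar graded_const)
    show "graded p n 0 (\<lambda>x. pstar x y)"
      using graded_pstar[of n 0 y] by simp
  qed simp_all
  then have "average p \<xi> (\<lambda>x. dpstar x (pstar x y) z) x = average p \<xi> (\<lambda>x. dpstar 0 (pstar x y) z) x"
    by (simp add: average_diff)
  also have "\<dots> = dpstar 0 (average p \<xi> (\<lambda>x. pstar x y) x) z"
    by (rule average_additive[OF additive_dpstar, symmetric])
  finally show ?thesis by (simp add: dpstar_0)
qed

text \<open>The inner average is the derivative at \<open>u\<close> in direction
  \<open>lam (p u) y = y + pstar u y\<close>. The direction \<open>y\<close> gives the mixed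
  second-order term, the direction \<open>pstar u y\<close> the iterated product.\<close>

lemma average_pstar_circ:
  "average p \<xi> (\<lambda>u. average p \<xi> (\<lambda>v. pstar (u + lam (gmult p u) v) z) y) x
    = average p \<xi> (\<lambda>u. average p \<xi> (\<lambda>v. pstar (u + v) z) y) x + dpstar 0 (dpstar 0 x y) z"
proof -
  have "average p \<xi> (\<lambda>v. pstar (u + lam (gmult p u) v) z) y = dpstar u y z + dpstar u (pstar u y) z" for u
  proof -
    have "average p \<xi> (\<lambda>v. pstar (u + lam (gmult p u) v) z) y = dpstar u (lam (gmult p u) y) z"
      by (simp add: dpstar_def average_def gmult_additive[OF additive_lam])
    then show ?thesis
      by (simp add: lam_eq additive.add[OF additive_dpstar] pstar_def)
  qed
  then show ?thesis
    by (simp add: average_add average_dpstar_pstar) (simp add: dpstar_def)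
qed

lemma dpstar_commutator:
  "dpstar 0 (dpstar 0 x y) z - dpstar 0 (dpstar 0 y x) z
    = dpstar 0 x (dpstar 0 y z) - dpstar 0 y (dpstar 0 x z)"
proof -
  let ?A = "average p \<xi>"
  have compose: "?A (\<lambda>u. ?A (\<lambda>v. pstar u (pstar v z)) y) x = dpstar 0 x (dpstar 0 y z)" for x y
    unfolding average_additive[OF additive_pstar, symmetric] by (simp add: dpstar_0)
  have polar: "?A (\<lambda>u. ?A (\<lambda>v. pstar (u + v) z) b) a + dpstar 0 (dpstar 0 a b) z
      = ?A (\<lambda>u. ?A (\<lambda>v. pstar u z + pstar v z) b) a + dpstar 0 a (dpstar 0 b z)" for a b
    unfolding average_pstar_circ[symmetric] pstar_circ
    by (simp add: average_add compose)
  \<comment> \<open>The integrands are symmetric in \<open>u\<close> and \<open>v\<close> and the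
    averages commute, so these terms agree for both orders of \<open>x\<close> and \<open>y\<close>
    and cancel on subtraction.\<close>
  have "?A (\<lambda>u. ?A (\<lambda>v. pstar (u + v) z) y) x = ?A (\<lambda>u. ?A (\<lambda>v. pstar (u + v) z) x) y"
    by (subst average_commute) (simp add: add.commute)
  moreover have "?A (\<lambda>u. ?A (\<lambda>v. pstar u z + pstar v z) y) x = ?A (\<lambda>u. ?A (\<lambda>v. pstar u z + pstar v z) x) y"
    by (subst average_commute) (simp add: add.commute)
  ultimately have polar': "?A (\<lambda>u. ?A (\<lambda>v. pstar (u + v) z) y) x + dpstar 0 (dpstar 0 y x) z
      = ?A (\<lambda>u. ?A (\<lambda>v. pstar u z + pstar v z) y) x + dpstar 0 y (dpstar 0 x z)"
    using polar[of x y] by simp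
  show ?thesis
    using arg_cong2[OF polar[of y x] polar', of minus] by (simp only: add_diff_cancel_left)
qed

lemma gmult_dpstar_eq_0:
  assumes "gmult (p ^ 2) x = 0"
  shows "gmult p (dpstar 0 x y) = 0"
proof -
  have "gmult p (dpstar 0 x y) = dpstar 0 (gmult p x) y"
    by (rule gmult_additive[OF additive_dpstar, symmetric])
  also have "gmult p (gmult m (gmult p x)) = 0" for m
    using assms by (metis gmult_commute gmult_mult gmult_zero power2_eq_square)
  then have "dpstar 0 (gmult p x) y = 0"
    by (simp add: dpstar_0 average_def pstar_def)
  finally show ?thesis .
qed

text \<open>\<open>p y\<close> is killed by \<open>p\<close>, hence also by left stars with elements
  of \<open>p A\<close>.\<close>

lemma gmult_dpstar_eq_0':
  assumes "gmult (p ^ 2) y = 0"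
  shows "gmult p (dpstar 0 x y) = 0"
proof -
  have "gmult p (dpstar 0 x y) = dpstar 0 x (gmult p y)"
    by (rule gmult_additive[OF additive_dpstar_0, symmetric])
  also have "star (gmult p a) (gmult p y) = 0" for a
    using star_gmult_eq_0[of 1 "gmult p y" a] assms by (simp add: power2_eq_square gmult_mult)
  then have "dpstar 0 x (gmult p y) = 0"
    by (simp add: dpstar_0 average_def pstar_def)
  finally show ?thesis .
qed

text \<open>The stars involved lie in \<open>p A\<close>, so multiplication by \<open>p\<close>
  undoes \<open>wp\<close>, whatever preimages it selects.\<close>

lemma gmult_bullet:
  assumes "\<forall>a\<in>range (gmult p). gmult p (wp a) = a"
  shows "gmult p (bullet circ wp p \<xi> x y) = dpstar 0 x y"
proof -
  have "gmult p (wp (star (gmult p a) b)) = pstar a b" for a b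
    using bspec[OF assms, of "star (gmult p a) b"] star_multiples[of "gmult p a" 1 b]
    by (simp add: pstar_def multiples_def)
  moreover have "{0..p - 2} = {..<p - 1}" using big by auto
  ultimately show ?thesis
    by (simp add: bullet_def dpstar_0 average_def gmult_sum gmult_commute[of p _ "wp z" for z])
qed

text \<open>Identities in the quotient can be checked after multiplying by \<open>p\<close> twice,
  where \<open>wp\<close> disappears.\<close>

lemma cong_ann_iff: "cong_ann p x y \<longleftrightarrow> gmult p (gmult p x) = gmult p (gmult p y)"
  by (simp add: cong_ann_def ann_def gmult_diff power2_eq_square gmult_mult)

end

section \<open>Transfer to the quotient by \<open>ann (p ^ 2)\<close>\<close>

theorem theorem8p1:
  fixes circ :: "'a::{ab_group_add,finite} \<Rightarrow> 'a \<Rightarrow> 'a"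
    and wp :: "'a \<Rightarrow> 'a"
    and p n \<gamma> \<xi> :: nat
  assumes brace: "left_brace circ"
    and card: "card (UNIV :: 'a set) = p ^ n"
    and prime: "prime p"
    and big: "p > n + 1"
    and wp: "\<forall>a \<in> range (gmult p). gmult p (wp a) = a"
    and prim: "residue_primroot (p ^ p) \<gamma>"
    and xi: "\<xi> = \<gamma> ^ (p ^ (p - 1))"
  shows
    "(\<forall>x x' y y'. cong_ann p x x' \<longrightarrow> cong_ann p y y' \<longrightarrow>
        cong_ann p (bullet circ wp p \<xi> x y) (bullet circ wp p \<xi> x' y'))
     \<and> (\<forall>x x' y. cong_ann p (bullet circ wp p \<xi> (x + x') y)
                  (bullet circ wp p \<xi> x y + bullet circ wp p \<xi> x' y))
     \<and> (\<forall>x y y'. cong_ann p (bullet circ wp p \<xi> x (y + y'))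
                  (bullet circ wp p \<xi> x y + bullet circ wp p \<xi> x y'))
     \<and> (\<forall>x y z. cong_ann p
          (bullet circ wp p \<xi> (bullet circ wp p \<xi> x y) z
             - bullet circ wp p \<xi> x (bullet circ wp p \<xi> y z))
          (bullet circ wp p \<xi> (bullet circ wp p \<xi> y x) z
             - bullet circ wp p \<xi> y (bullet circ wp p \<xi> x z)))"
proof -
  interpret p_brace_unit circ p n \<xi>
  proof unfold_locales
    \<comment> \<open>As \<open>n < p\<close>, the congruence modulo \<open>p ^ p\<close> descends
      to \<open>p ^ n\<close>.\<close>
    show "[\<xi> ^ (p - 1) = 1] (mod p ^ n)"
      using cong_dvd_modulus_nat[OF primroot_power_cong_1[OF prime prim], of "p ^ n"] big
      by (simp add: xi le_imp_power_dvd)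
    show "\<not> [\<xi> ^ k = 1] (mod p)" if "0 < k" "k < p - 1" for k
      using primroot_power_not_cong_1[OF prime prim that] by (simp add: xi)
    have "coprime (p ^ p) \<gamma>" using prim by (simp add: residue_primroot_def)
    then have "coprime p \<gamma>" using big by (simp add: coprime_power_left_iff)
    then show "\<not> p dvd \<xi>"
      using prime by (metis coprime_absorb_left not_prime_unit prime_dvd_power xi)
  qed (use assms in auto)
  define b where "b = bullet circ wp p \<xi>"
  have gb: "gmult p (b x y) = dpstar 0 x y" for x y
    unfolding b_def by (rule gmult_bullet[OF wp])
  have wd: "cong_ann p (b x y) (b x' y')" if "cong_ann p x x'" "cong_ann p y y'" for x x' y y'
  proof -
    have z: "gmult (p ^ 2) (x - x') = 0" "gmult (p ^ 2) (y - y') = 0"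
      using that by (simp_all add: cong_ann_def ann_def)
    have "dpstar 0 x y - dpstar 0 x' y' = dpstar 0 (x - x') y + dpstar 0 x' (y - y')"
      by (simp add: additive.diff[OF additive_dpstar] additive.diff[OF additive_dpstar_0])
    then have "gmult p (dpstar 0 x y) - gmult p (dpstar 0 x' y') = 0"
      using gmult_dpstar_eq_0[OF z(1)] gmult_dpstar_eq_0'[OF z(2)]
      by (metis gmult_diff gmult_add_right add_0)
    then show ?thesis by (simp add: cong_ann_iff gb)
  qed
  \<comment> \<open>One factor \<open>p\<close> removes the outer \<open>wp\<close>; additivity
    moves the other one to the inner product, where it removes the second.\<close>
  have left: "gmult p (gmult p (b (b x y) z)) = dpstar 0 (dpstar 0 x y) z" for x y z
    by (simp add: gb flip: gmult_additive[OF additive_dpstar])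
  have right: "gmult p (gmult p (b x (b y z))) = dpstar 0 x (dpstar 0 y z)" for x y z
    by (simp add: gb flip: gmult_additive[OF additive_dpstar_0])
  have "cong_ann p (b (b x y) z - b x (b y z)) (b (b y x) z - b y (b x z))" for x y z
    using dpstar_commutator[of x y z]
    by (simp only: cong_ann_iff gmult_diff left right) (simp add: algebra_simps)
  moreover have "cong_ann p (b (x + x') y) (b x y + b x' y)" for x x' y
    by (simp add: cong_ann_iff gmult_add_right gb additive.add[OF additive_dpstar])
  moreover have "cong_ann p (b x (y + y')) (b x y + b x y')" for x y y'
    by (simp add: cong_ann_iff gmult_add_right gb additive.add[OF additive_dpstar_0])
  ultimately show ?thesis
    using wd unfolding b_def by blast
qed

end
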